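(* Let $(X,d)$ be a finite nonempty ultrametric space with $|X|=n$ and representing tree $T_X$. Let $(x_1,\dots,x_n)$ be any sequence of points of $X$ produced by the following procedure (Algorithm 3): $x_1\in X$ is arbitrary (that is, $\{x_1\}$ is an arbitrary leaf of $T_X$) and $P_1:=\{x_1\}$; for $i=1,\dots,n-1$, choose a node $v_i\in V(T_X)$ of the largest possible level among all nodes $v$ of $T_X$ satisfying $x_i\in L(T_v)$ and $L(T_v)\setminus P_i\neq\varnothing$, then choose an arbitrary point $x_{i+1}\in L(T_{v_i})\setminus P_i$ and set $P_{i+1}:=P_i\cup\{x_{i+1}\}$. Then the path with vertex set $\{x_1,\dots,x_n\}=X$ and edge set $\{\{x_1,x_2\},\dots,\{x_{n-1},x_n\}\}$ is a minimum spanning path of $X$, i.e. it is a minimum spanning tree of $(X,d)$.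
   Context: An ultrametric space $(X,d)$ is a metric space with $d(x,y)\le\max\{d(x,z),d(z,y)\}$ for all $x,y,z$. Minimum spanning tree: a finite metric space $(X,d)$ is regarded as the complete weighted graph $(G_X,w)$ with $V(G_X)=X$ and $w(\{x,y\})=d(x,y)$ for $x\ne y$. A minimum spanning tree of $(X,d)$ is a spanning tree of $G_X$ whose sum of edge weights is smallest among all spanning trees of $(G_X,w)$. A path is a nonempty graph whose vertices can be numbered $x_1,\dots,x_k$ (distinct) so that its edges are exactly $\{x_1,x_2\},\dots,\{x_{k-1},x_k\}$ (a single vertex is allowed). Representing tree: for a finite ultrametric space $X$ with $|X|\ge 2$, the diametrical graph $G_{D,X}$ has vertex set $X$, with $u,v$ adjacent iff $d(u,v)=\operatorname{diam}X$; it is known to be a complete multipartite graph with parts $X_1,\dots,X_k$, $k\ge2$ (the parts are the classes of the equivalence relation $d(u,v)<\operatorname{diam}X$). The representing tree $T_X$ is the labeled rooted tree whose nodes are subsets of $X$, constructed as follows: the root is $X$ with label $\operatorname{diam}X$; if $|X|=1$, $T_X$ consists of the root only (which is a leaf, with label $0$); if $|X|\ge2$, the children of the root are the parts $X_1,\dots,X_k$ of $G_{D,X}$, each labeled $l(X_i)=\operatorname{diam}X_i$; nodes of label $0$ (singletons) are leaves, and the construction is repeated at each node $X_i$ with $\operatorname{diam}X_i>0$, using the subspace $X_i$ in place of $X$, and so on. The level of a node is the length of the path from the root to it. For a node $v$, $T_v$ is the rooted subtree consisting of $v$ and all its successors (descendants), and $L(T_v)$ is the set of points $x\in X$ such that $\{x\}$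 is a leaf of $T_v$. *)

theory Defs
  imports "HOL-Analysis.Analysis"
begin

section \<open>Undirected graphs and minimum spanning trees\<close>

record 'a ugraph =
  verts :: "'a set"
  edges :: "'a set set"

text \<open>No loops and no parallel edges: an edge is an unordered pair of distinct vertices.\<close>

definition simple_graph :: "'a ugraph \<Rightarrow> bool" where
  "simple_graph G \<longleftrightarrow>
     edges G \<subseteq> {{u, v} | u v. u \<in> verts G \<and> v \<in> verts G \<and> u \<noteq> v}"

definition path_edges :: "'a list \<Rightarrow> 'a set set" where
  "path_edges xs = {{xs ! i, xs ! Suc i} | i. Suc i < length xs}"

definition cycle_edges :: "'a list \<Rightarrow> 'a set set" where
  "cycle_edges xs = insert {last xs, hd xs} (path_edges xs)"

definition is_path :: "'a ugraph \<Rightarrow> bool" where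
  "is_path G \<longleftrightarrow>
     (\<exists>xs. xs \<noteq> [] \<and> distinct xs \<and> verts G = set xs \<and> edges G = path_edges xs)"

definition connected_graph :: "'a ugraph \<Rightarrow> bool" where
  "connected_graph G \<longleftrightarrow>
     (\<forall>u\<in>verts G. \<forall>v\<in>verts G. \<exists>xs. xs \<noteq> [] \<and> distinct xs \<and> set xs \<subseteq> verts G \<and>
        path_edges xs \<subseteq> edges G \<and> hd xs = u \<and> last xs = v)"

definition acyclic_graph :: "'a ugraph \<Rightarrow> bool" where
  "acyclic_graph G \<longleftrightarrow>
     (\<nexists>xs. 3 \<le> length xs \<and> distinct xs \<and> set xs \<subseteq> verts G \<and> cycle_edges xs \<subseteq> edges G)"

definition is_tree :: "'a ugraph \<Rightarrow> bool" where
  "is_tree G \<longleftrightarrow>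
     simple_graph G \<and> verts G \<noteq> {} \<and> connected_graph G \<and> acyclic_graph G"

definition spanning_tree :: "'a ugraph \<Rightarrow> 'a ugraph \<Rightarrow> bool" where
  "spanning_tree G T \<longleftrightarrow> is_tree T \<and> verts T = verts G \<and> edges T \<subseteq> edges G"

definition minimum_spanning_tree :: "'a ugraph \<Rightarrow> ('a set \<Rightarrow> real) \<Rightarrow> 'a ugraph \<Rightarrow> bool" where
  "minimum_spanning_tree G w T \<longleftrightarrow>
     spanning_tree G T \<and> (\<forall>T'. spanning_tree G T' \<longrightarrow> sum w (edges T) \<le> sum w (edges T'))"


section \<open>Finite (ultra)metric spaces as weighted graphs\<close>

locale Ultrametric_space = Metric_space +
  assumes ultrametric:
    "\<lbrakk>x \<in> M; y \<in> M; z \<in> M\<rbrakk> \<Longrightarrow> d x y \<le> max (d x z) (d z y)"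

text \<open>The complete weighted graph \<open>(G\<^sub>X, w)\<close>. The weight of an edge is well defined
  because \<open>d\<close> is symmetric.\<close>

definition metric_graph :: "'a set \<Rightarrow> 'a ugraph" where
  "metric_graph X = \<lparr>verts = X, edges = {{x, y} | x y. x \<in> X \<and> y \<in> X \<and> x \<noteq> y}\<rparr>"

definition metric_weight :: "('a \<Rightarrow> 'a \<Rightarrow> real) \<Rightarrow> 'a set \<Rightarrow> real" where
  "metric_weight d e = (THE r. \<exists>x y. e = {x, y} \<and> r = d x y)"

lemma (in Metric_space) metric_weight_pair [simp]: "metric_weight d {x, y} = d x y"
  unfolding metric_weight_def
  by (rule the_equality) (auto simp: doubleton_eq_iff commute)

definition metric_minimum_spanning_path ::
    "'a set \<Rightarrow> ('a \<Rightarrow> 'a \<Rightarrow> real) \<Rightarrow> 'a ugraph \<Rightarrow> bool" where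
  "metric_minimum_spanning_path X d G \<longleftrightarrow>
     is_path G \<and> minimum_spanning_tree (metric_graph X) (metric_weight d) G"


section \<open>The diametrical graph\<close>

text \<open>The library constant \<open>diameter\<close> is only available for the type class of metric spaces;
  this is its analogue for an explicit distance function.\<close>

definition mdiam :: "('a \<Rightarrow> 'a \<Rightarrow> real) \<Rightarrow> 'a set \<Rightarrow> real" where
  "mdiam d A = (if A = {} then 0 else (SUP (x, y)\<in>A \<times> A. d x y))"

definition diametrical_graph :: "('a \<Rightarrow> 'a \<Rightarrow> real) \<Rightarrow> 'a set \<Rightarrow> 'a ugraph" where
  "diametrical_graph d A =
     \<lparr>verts = A, edges = {{u, v} | u v. u \<in> A \<and> v \<in> A \<and> u \<noteq> v \<and> d u v = mdiam d A}\<rparr>"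

definition complete_multipartite :: "'a ugraph \<Rightarrow> 'a set set \<Rightarrow> bool" where
  "complete_multipartite G P \<longleftrightarrow>
     partition_on (verts G) P \<and>
     edges G = {{u, v} | u v A B. A \<in> P \<and> B \<in> P \<and> A \<noteq> B \<and> u \<in> A \<and> v \<in> B}"

text \<open>In a complete multipartite graph, the parts are the classes of the non-adjacency
  relation.\<close>

definition parts :: "'a ugraph \<Rightarrow> 'a set set" where
  "parts G = verts G // {(u, v) \<in> verts G \<times> verts G. {u, v} \<notin> edges G}"

lemma parts_complete_multipartite:
  assumes "complete_multipartite G P"
  shows "parts G = P"
proof -
  have P: "partition_on (verts G) P"
    and E: "edges G = {{u, v} | u v A B. A \<in> P \<and> B \<in> P \<and> A \<noteq> B \<and> u \<in> A \<and> v \<in> B}"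
    using assms by (auto simp: complete_multipartite_def)
  have uniq: "A = B" if "A \<in> P" "B \<in> P" "u \<in> A" "u \<in> B" for A B u
    using P that by (meson disjoint_iff partition_onD2 disjointD)
  have adj: "{u, v} \<in> edges G \<longleftrightarrow> A \<noteq> B" if "A \<in> P" "B \<in> P" "u \<in> A" "v \<in> B" for u v A B
  proof
    assume "{u, v} \<in> edges G"
    then obtain u' v' C D where "{u, v} = {u', v'}" "C \<in> P" "D \<in> P" "C \<noteq> D" "u' \<in> C" "v' \<in> D"
      unfolding E by blast
    then show "A \<noteq> B" using that uniq by (metis doubleton_eq_iff)
  next
    assume "A \<noteq> B"
    then show "{u, v} \<in> edges G" unfolding E using that by blast
  qed
  have "{(u, v) \<in> verts G \<times> verts G. {u, v} \<notin> edges G} = {(u, v). \<exists>A\<in>P. u \<in> A \<and> v \<in> A}"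
    (is "?N = ?R")
  proof (rule set_eqI, clarify)
    fix u v
    have "(\<exists>A\<in>P. u \<in> A \<and> v \<in> A) \<longleftrightarrow> u \<in> \<Union>P \<and> v \<in> \<Union>P \<and> {u, v} \<notin> edges G"
      using adj by (metis Union_iff)
    then show "(u, v) \<in> ?N \<longleftrightarrow> (u, v) \<in> ?R"
      using partition_onD1[OF P] by simp
  qed
  then show ?thesis
    unfolding parts_def using partition_on_eq_quotient[OF P] by simp
qed

lemma (in Metric_space) mdiam_ge:
  assumes "finite A" "u \<in> A" "v \<in> A"
  shows "d u v \<le> mdiam d A"
proof -
  have "bdd_above ((\<lambda>(x, y). d x y) ` (A \<times> A))"
    using assms by (intro bdd_above_finite) auto
  then show ?thesis
    using assms cSUP_upper[of "(u, v)" "A \<times> A" "\<lambda>(x, y). d x y"]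
    by (auto simp: mdiam_def)
qed

lemma (in Ultrametric_space) diametrical_graph_parts:
  assumes "A \<subseteq> M" "finite A" "2 \<le> card A"
  shows "complete_multipartite (diametrical_graph d A) (parts (diametrical_graph d A))"
    and "parts (diametrical_graph d A) = A // {(u, v) \<in> A \<times> A. d u v < mdiam d A}"
proof -
  let ?r = "{(u, v) \<in> A \<times> A. d u v < mdiam d A}"
  obtain a b where ab: "a \<in> A" "b \<in> A" "a \<noteq> b"
    using assms(3) using card_le_Suc0_iff_eq[OF assms(2)] by force
  have "0 < d a b" using ab assms(1) by (meson mdist_pos_less subsetD)
  then have pos: "0 < mdiam d A" using mdiam_ge[OF assms(2) ab(1,2)] by linarith
  have eq: "equiv A ?r"
  proof (rule equivI)
    show "refl_on A ?r" using pos assms(1) by (auto simp: refl_on_def subset_iff)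
    show "sym ?r" by (auto simp: sym_def commute)
    show "trans ?r"
    proof (rule transI)
      fix x y z assume "(x, y) \<in> ?r" "(y, z) \<in> ?r"
      then have r: "x \<in> A" "y \<in> A" "z \<in> A" "d x y < mdiam d A" "d y z < mdiam d A" by auto
      then have "d x z \<le> max (d x y) (d y z)" using assms(1) by (intro ultrametric) auto
      also have "\<dots> < mdiam d A" using r by simp
      finally show "(x, z) \<in> ?r" using r by simp
    qed
  qed auto
  have E: "{u, v} \<in> edges (diametrical_graph d A) \<longleftrightarrow> (u, v) \<notin> ?r"
    if "u \<in> A" "v \<in> A" for u v
  proof -
    have "{u, v} \<in> edges (diametrical_graph d A) \<longleftrightarrow> u \<noteq> v \<and> d u v = mdiam d A"
      using that commute by (auto simp: diametrical_graph_def doubleton_eq_iff)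
    moreover have "u \<noteq> v" if "d u v = mdiam d A"
      using that pos \<open>u \<in> A\<close> assms(1) by auto
    ultimately show ?thesis
      using that mdiam_ge[OF assms(2) that] by auto
  qed
  have "{(u, v) \<in> A \<times> A. {u, v} \<notin> edges (diametrical_graph d A)} = ?r"
    using E by auto
  then show parts: "parts (diametrical_graph d A) = A // ?r"
    by (simp add: parts_def diametrical_graph_def)
  have "edges (diametrical_graph d A) =
      {{u, v} | u v. u \<in> A \<and> v \<in> A \<and> (u, v) \<notin> ?r}"
  proof (intro set_eqI iffI)
    fix e assume e: "e \<in> edges (diametrical_graph d A)"
    then obtain u v where "u \<in> A" "v \<in> A" "e = {u, v}"
      by (auto simp: diametrical_graph_def)
    with e E show "e \<in> {{u, v} | u v. u \<in> A \<and> v \<in> A \<and> (u, v) \<notin> ?r}" by blast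
  next
    fix e assume "e \<in> {{u, v} | u v. u \<in> A \<and> v \<in> A \<and> (u, v) \<notin> ?r}"
    then obtain u v where "u \<in> A" "v \<in> A" "e = {u, v}" "(u, v) \<notin> ?r" by blast
    then show "e \<in> edges (diametrical_graph d A)" using E by blast
  qed
  also have "\<dots> = {{u, v} | u v B C. B \<in> A // ?r \<and> C \<in> A // ?r \<and> B \<noteq> C \<and> u \<in> B \<and> v \<in> C}"
  proof -
    have "u \<in> A \<and> v \<in> A \<and> (u, v) \<notin> ?r \<longleftrightarrow>
        (\<exists>B C. B \<in> A // ?r \<and> C \<in> A // ?r \<and> B \<noteq> C \<and> u \<in> B \<and> v \<in> C)" for u v
    proof
      assume *: "u \<in> A \<and> v \<in> A \<and> (u, v) \<notin> ?r"
      then have "?r `` {u} \<noteq> ?r `` {v}" using eq_equiv_class[OF _ eq] by blast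
      moreover have "?r `` {u} \<in> A // ?r" "?r `` {v} \<in> A // ?r"
        using * by (blast intro: quotientI)+
      moreover have "u \<in> ?r `` {u}" "v \<in> ?r `` {v}"
        using * equiv_class_self[OF eq] by blast+
      ultimately show "\<exists>B C. B \<in> A // ?r \<and> C \<in> A // ?r \<and> B \<noteq> C \<and> u \<in> B \<and> v \<in> C"
        by blast
    next
      assume "\<exists>B C. B \<in> A // ?r \<and> C \<in> A // ?r \<and> B \<noteq> C \<and> u \<in> B \<and> v \<in> C"
      then obtain B C where "B \<in> A // ?r" "C \<in> A // ?r" "B \<noteq> C" "u \<in> B" "v \<in> C" by blast
      then show "u \<in> A \<and> v \<in> A \<and> (u, v) \<notin> ?r"
        using quotient_eq_iff[OF eq, of B C u v] in_quotient_imp_subset[OF eq, of B]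
          in_quotient_imp_subset[OF eq, of C] by blast
    qed
    then show ?thesis by simp
  qed
  finally show "complete_multipartite (diametrical_graph d A) (parts (diametrical_graph d A))"
    unfolding complete_multipartite_def parts
    using partition_on_quotient[OF eq] by (simp add: diametrical_graph_def)
qed


section \<open>Rooted trees and the representing tree\<close>

text \<open>The pairs in \<open>tree_arcs\<close> point from a node to its children.\<close>

record 'v rooted_tree =
  nodes :: "'v set"
  tree_arcs :: "'v rel"
  root :: 'v
  label :: "'v \<Rightarrow> real"

definition level :: "'v rooted_tree \<Rightarrow> 'v \<Rightarrow> nat" where
  "level T v = (THE k. (root T, v) \<in> tree_arcs T ^^ k)"

definition subtree :: "'v rooted_tree \<Rightarrow> 'v \<Rightarrow> 'v rooted_tree" where
  "subtree T v = (let S = (tree_arcs T)\<^sup>* `` {v} in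
     \<lparr>nodes = S, tree_arcs = tree_arcs T \<inter> S \<times> S, root = v, label = label T\<rparr>)"

definition leaves :: "'v rooted_tree \<Rightarrow> 'v set" where
  "leaves T = {v \<in> nodes T. tree_arcs T `` {v} = {}}"

definition leaf_points :: "'a set rooted_tree \<Rightarrow> 'a set" where
  "leaf_points T = {x. {x} \<in> leaves T}"

inductive_set rep_nodes :: "('a \<Rightarrow> 'a \<Rightarrow> real) \<Rightarrow> 'a set \<Rightarrow> 'a set set"
  for d :: "'a \<Rightarrow> 'a \<Rightarrow> real" and X :: "'a set" where
  root: "X \<in> rep_nodes d X"
| child: "\<lbrakk>A \<in> rep_nodes d X; 0 < mdiam d A; B \<in> parts (diametrical_graph d A)\<rbrakk>
    \<Longrightarrow> B \<in> rep_nodes d X"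

definition rep_tree :: "('a \<Rightarrow> 'a \<Rightarrow> real) \<Rightarrow> 'a set \<Rightarrow> 'a set rooted_tree" where
  "rep_tree d X =
     \<lparr>nodes = rep_nodes d X,
      tree_arcs = {(A, B). A \<in> rep_nodes d X \<and> 0 < mdiam d A \<and> B \<in> parts (diametrical_graph d A)},
      root = X,
      label = mdiam d\<rparr>"


section \<open>The algorithm\<close>

text \<open>\<open>deepest_node_run d X x\<close> says that \<open>x 1, \<dots>, x n\<close> with \<open>n = card X\<close> is a possible run;
  the values of \<open>x\<close> at other indices are irrelevant. The set \<open>P\<^sub>i\<close> of points visited so far is
  \<open>x ` {1..i}\<close>.\<close>

definition deepest_node_run :: "('a \<Rightarrow> 'a \<Rightarrow> real) \<Rightarrow> 'a set \<Rightarrow> (nat \<Rightarrow> 'a) \<Rightarrow> bool" where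
  "deepest_node_run d X x \<longleftrightarrow>
     x 1 \<in> X \<and>
     (\<forall>i\<in>{1..<card X}. \<exists>v.
        is_arg_max (level (rep_tree d X))
          (\<lambda>v. v \<in> nodes (rep_tree d X) \<and>
               x i \<in> leaf_points (subtree (rep_tree d X) v) \<and>
               leaf_points (subtree (rep_tree d X) v) - x ` {1..i} \<noteq> {}) v \<and>
        x (i + 1) \<in> leaf_points (subtree (rep_tree d X) v) - x ` {1..i})"

end

theory Submission
  imports Defs
begin

text \<open>
  The node chosen by the algorithm is the smallest node of the representing tree that contains the
  current point and some unvisited point. Since the distance of two points is the diameter of the
  smallest node containing both, every step goes to a nearest unvisited point
  (\<open>deepest_node_run_nearest\<close>).

  In an ultrametric space this greedy walk cannot leave a ball before having visited all of it, and
  therefore the step from \<open>x i\<close> is not only a shortest way from \<open>x i\<close>, but a shortest way from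
  the whole visited set to its complement (\<open>nearest_neighbour_crosses_cut\<close>): the walk is a run of
  Prim's algorithm in which every new edge happens to start at the point added last.

  Optimality does not need an exchange of edges between trees. Let \<open>E\<close> be the edges of any connected
  graph on the same points and contract the visited set to one point. The route in \<open>E\<close> from the
  next point to the visited set uses an edge across the cut, which weighs at least as much as the
  greedy step; after the next point has been contracted as well, that edge can be deleted without
  disconnecting the graph. Repeating this charges the greedy steps to distinct edges of \<open>E\<close>
  (\<open>cut_steps_le_connecting_edges\<close>).
\<close>

section \<open>Paths are trees\<close>

lemma path_edgesE:
  assumes "e \<in> path_edges xs"
  obtains i where "Suc i < length xs" "e = {xs ! i, xs ! Suc i}"
  using assms unfolding path_edges_def by blast

lemma path_edges_take_drop: "path_edges (take k (drop i xs)) \<subseteq> path_edges xs"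
proof
  fix e assume "e \<in> path_edges (take k (drop i xs))"
  then obtain j where "Suc j < length (take k (drop i xs))"
    and "e = {take k (drop i xs) ! j, take k (drop i xs) ! Suc j}"
    by (rule path_edgesE)
  then have "Suc (i + j) < length xs \<and> e = {xs ! (i + j), xs ! Suc (i + j)}" by auto
  then show "e \<in> path_edges xs" unfolding path_edges_def by blast
qed

lemma path_edges_rev_subset: "path_edges (rev xs) \<subseteq> path_edges xs"
proof
  fix e assume "e \<in> path_edges (rev xs)"
  then obtain j where j: "Suc j < length xs" and e: "e = {rev xs ! j, rev xs ! Suc j}"
    by (auto simp: path_edges_def)
  define k where "k = length xs - Suc (Suc j)"
  have k: "length xs - Suc j = Suc k" using j by (simp add: k_def)
  then have "e = {xs ! k, xs ! Suc k}" using j e by (auto simp: rev_nth k_def)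
  moreover have "Suc k < length xs" using j by (simp add: k_def)
  ultimately show "e \<in> path_edges xs" unfolding path_edges_def by blast
qed

lemma is_path_imp_connected_graph:
  assumes "is_path G"
  shows "connected_graph G"
  unfolding connected_graph_def
proof (intro ballI)
  fix u v assume uv: "u \<in> verts G" "v \<in> verts G"
  from assms obtain xs where xs: "distinct xs" "verts G = set xs" "edges G = path_edges xs"
    unfolding is_path_def by blast
  have segment: "\<exists>ys. ys \<noteq> [] \<and> distinct ys \<and> set ys \<subseteq> set xs \<and> path_edges ys \<subseteq> path_edges xs \<and>
      hd ys = xs ! i \<and> last ys = xs ! j" if "i \<le> j" "j < length xs" for i j
  proof (intro exI conjI)
    let ?ys = "take (Suc (j - i)) (drop i xs)"
    show "?ys \<noteq> []" "distinct ?ys" using that xs by auto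
    show "set ?ys \<subseteq> set xs" by (meson order_trans set_drop_subset set_take_subset)
    show "path_edges ?ys \<subseteq> path_edges xs" by (rule path_edges_take_drop)
    show "hd ?ys = xs ! i" using that by (simp add: hd_drop_conv_nth)
    show "last ?ys = xs ! j" using that by (simp add: last_conv_nth)
  qed
  obtain i j where ij: "i < length xs" "u = xs ! i" "j < length xs" "v = xs ! j"
    using uv xs(2) by (metis in_set_conv_nth)
  show "\<exists>ys. ys \<noteq> [] \<and> distinct ys \<and> set ys \<subseteq> verts G \<and> path_edges ys \<subseteq> edges G \<and>
      hd ys = u \<and> last ys = v"
  proof (cases "i \<le> j")
    case True
    then show ?thesis using segment[of i j] ij xs by simp
  next
    case False
    then obtain ys where ys: "ys \<noteq> []" "distinct ys" "set ys \<subseteq> set xs"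
        "path_edges ys \<subseteq> path_edges xs" "hd ys = v" "last ys = u"
      using segment[of j i] ij by auto
    then show ?thesis
      using xs path_edges_rev_subset[of ys]
      by (intro exI[of _ "rev ys"]) (auto simp: hd_rev last_rev)
  qed
qed

text \<open>A cycle in a path would have a vertex that comes first on the path; both neighbours of that
  vertex on the cycle would have to be its single successor on the path.\<close>

lemma is_path_imp_acyclic_graph:
  assumes "is_path G"
  shows "acyclic_graph G"
  unfolding acyclic_graph_def
proof
  assume "\<exists>ys. 3 \<le> length ys \<and> distinct ys \<and> set ys \<subseteq> verts G \<and> cycle_edges ys \<subseteq> edges G"
  then obtain ys where ys: "3 \<le> length ys" "distinct ys" "set ys \<subseteq> verts G"
    "cycle_edges ys \<subseteq> edges G" by blast
  from assms obtain xs where xs: "distinct xs" "verts G = set xs" "edges G = path_edges xs"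
    unfolding is_path_def by blast
  define m where "m = length ys"
  have "\<forall>q<m. \<exists>k<length xs. xs ! k = ys ! q"
    using ys(3) xs(2) by (metis in_set_conv_nth m_def nth_mem subsetD)
  then obtain f where "\<forall>q<m. f q < length xs \<and> xs ! f q = ys ! q"
    by metis
  then have f: "f q < length xs" "xs ! f q = ys ! q" if "q < m" for q
    using that by blast+
  have consecutive: "f q = Suc (f p)"
    if "{ys ! p, ys ! q} \<in> cycle_edges ys" "p < m" "q < m" "f p \<le> f q" for p q
  proof -
    have "{ys ! p, ys ! q} \<in> path_edges xs" using that(1) ys(4) xs(3) by blast
    then obtain k where k: "Suc k < length xs" "{ys ! p, ys ! q} = {xs ! k, xs ! Suc k}"
      by (rule path_edgesE)
    from k(2) have "{xs ! f p, xs ! f q} = {xs ! k, xs ! Suc k}"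
      by (simp only: f(2)[OF that(2)] f(2)[OF that(3)])
    then have "f p = k \<and> f q = Suc k \<or> f p = Suc k \<and> f q = k"
      using k(1) f(1)[OF that(2)] f(1)[OF that(3)]
      by (simp add: doubleton_eq_iff nth_eq_iff_index_eq[OF xs(1)])
    then show ?thesis using that(4) by auto
  qed
  obtain p where "p < m" and p: "\<And>q. q < m \<Longrightarrow> f p \<le> f q"
  proof -
    have "finite (f ` {..<m})" "f ` {..<m} \<noteq> {}" using ys(1) by (auto simp: m_def lessThan_empty_iff)
    then have "Min (f ` {..<m}) \<in> f ` {..<m}" by (rule Min_in)
    then obtain p where "p < m" "f p = Min (f ` {..<m})" by auto
    then show ?thesis using that[of p] by simp
  qed
  (* The successor and the predecessor of position p, cyclically modulo m. *)
  define next_pos where "next_pos = (if Suc p = m then 0 else Suc p)"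
  define prev_pos where "prev_pos = (if p = 0 then m - 1 else p - 1)"
  have m: "3 \<le> m" using ys(1) by (simp add: m_def)
  have pos: "next_pos < m" "prev_pos < m" "next_pos \<noteq> prev_pos"
    using \<open>p < m\<close> m by (auto simp: next_pos_def prev_pos_def)
  have step: "{ys ! k, ys ! Suc k} \<in> cycle_edges ys" if "Suc k < m" for k
    using that by (auto simp: cycle_edges_def path_edges_def m_def)
  have close: "{ys ! (m - 1), ys ! 0} \<in> cycle_edges ys"
  proof -
    have "ys \<noteq> []" using ys(1) by auto
    then show ?thesis by (simp add: cycle_edges_def m_def hd_conv_nth last_conv_nth)
  qed
  have "{ys ! p, ys ! next_pos} \<in> cycle_edges ys"
    using step[of p] close \<open>p < m\<close> by (auto simp: next_pos_def)
  moreover have "{ys ! p, ys ! prev_pos} \<in> cycle_edges ys"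
    using step[of "p - 1"] close \<open>p < m\<close> by (auto simp: prev_pos_def insert_commute)
  ultimately have "f next_pos = f prev_pos"
    using consecutive[OF _ \<open>p < m\<close>] pos p by simp
  then have "ys ! next_pos = ys ! prev_pos" using f pos by metis
  then show False using pos ys(2) by (simp add: m_def nth_eq_iff_index_eq)
qed

lemma is_path_imp_is_tree:
  assumes "is_path G"
  shows "is_tree G"
proof -
  from assms obtain xs where xs: "xs \<noteq> []" "distinct xs" "verts G = set xs" "edges G = path_edges xs"
    unfolding is_path_def by blast
  have "simple_graph G"
    unfolding simple_graph_def
  proof
    fix e assume "e \<in> edges G"
    then obtain i where "Suc i < length xs" "e = {xs ! i, xs ! Suc i}"
      unfolding xs(4) by (rule path_edgesE)
    then show "e \<in> {{u, v} |u v. u \<in> verts G \<and> v \<in> verts G \<and> u \<noteq> v}"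
      using xs(2,3) nth_eq_iff_index_eq[of xs i "Suc i"]
      by (intro CollectI exI[of _ "xs ! i"] exI[of _ "xs ! Suc i"]) auto
  qed
  then show ?thesis
    using xs is_path_imp_connected_graph[OF assms] is_path_imp_acyclic_graph[OF assms]
    by (simp add: is_tree_def)
qed


section \<open>A lower bound for the weight of a connected graph\<close>

definition adjacency :: "'a set set \<Rightarrow> 'a rel" where
  "adjacency E = {(u, v). {u, v} \<in> E}"

lemma adjacency_rtrancl_sym: "(u, v) \<in> (adjacency E)\<^sup>* \<Longrightarrow> (v, u) \<in> (adjacency E)\<^sup>*"
  by (rule symD[OF sym_rtrancl]) (auto simp: sym_def adjacency_def insert_commute)

lemma path_edges_imp_rtrancl:
  assumes "path_edges xs \<subseteq> E" "i < length xs"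
  shows "(xs ! 0, xs ! i) \<in> (adjacency E)\<^sup>*"
  using assms(2)
proof (induction i)
  case (Suc i)
  then have "(xs ! i, xs ! Suc i) \<in> adjacency E"
    using assms(1) unfolding adjacency_def path_edges_def by auto
  then show ?case using Suc by (auto intro: rtrancl_into_rtrancl)
qed simp

lemma connected_graph_imp_rtrancl:
  assumes "connected_graph G" "u \<in> verts G" "v \<in> verts G"
  shows "(u, v) \<in> (adjacency (edges G))\<^sup>*"
proof -
  obtain xs where "xs \<noteq> []" "path_edges xs \<subseteq> edges G" "hd xs = u" "last xs = v"
    using assms unfolding connected_graph_def by blast
  then show ?thesis
    using path_edges_imp_rtrancl[of xs "edges G" "length xs - 1"]
    by (simp add: hd_conv_nth last_conv_nth)
qed

text \<open>The last edge by which a route from \<open>P\<close> to \<open>t\<close> leaves \<open>P\<close>. What follows on the route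
  never meets \<open>P\<close> and so does not use this edge again.\<close>

lemma last_crossing_edge:
  assumes "(u, t) \<in> (adjacency E)\<^sup>*" "u \<in> P" "t \<notin> P"
  obtains a b where "a \<in> P" "b \<notin> P" "{a, b} \<in> E" "(b, t) \<in> (adjacency (E - {{a, b}}))\<^sup>*"
proof -
  have "\<exists>a b. a \<in> P \<and> b \<notin> P \<and> {a, b} \<in> E \<and> (b, t) \<in> (adjacency (E - {{a, b}}))\<^sup>*"
    using assms
  proof (induction rule: rtrancl_induct)
    case (step s t)
    show ?case
    proof (cases "s \<in> P")
      case True
      then show ?thesis using step.hyps(2) step.prems by (auto simp: adjacency_def)
    next
      case False
      then obtain a b where ab: "a \<in> P" "b \<notin> P" "{a, b} \<in> E"
          "(b, s) \<in> (adjacency (E - {{a, b}}))\<^sup>*"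
        using step.IH step.prems by blast
      have "{s, t} \<noteq> {a, b}" using False step.prems ab(1) by auto
      then have "(s, t) \<in> adjacency (E - {{a, b}})"
        using step.hyps(2) by (auto simp: adjacency_def)
      with ab show ?thesis by (meson rtrancl_into_rtrancl)
    qed
  qed simp
  with that show thesis by blast
qed

text \<open>Reachability of a set \<open>P\<close> from every vertex is connectedness of the graph in which \<open>P\<close> is
  contracted to a point. Contracting one more point \<open>t\<close> closes a cycle (or, if
  \<open>b = t\<close>, a loop) through the edge found in \<open>last_crossing_edge\<close>, which becomes dispensable.\<close>

lemma contract_and_delete:
  assumes "(z, u) \<in> (adjacency E)\<^sup>*" "u \<in> P"
    and "a \<in> P" "(b, t) \<in> (adjacency (E - {{a, b}}))\<^sup>*"
  shows "\<exists>u'\<in>insert t P. (z, u') \<in> (adjacency (E - {{a, b}}))\<^sup>*"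
  using assms(1)
proof (induction rule: converse_rtrancl_induct)
  case base
  then show ?case using assms(2) by blast
next
  case (step z z')
  show ?case
  proof (cases "{z, z'} = {a, b}")
    case True
    then have "z = a \<or> z = b" by (auto simp: doubleton_eq_iff)
    then show ?thesis using assms(3,4) by blast
  next
    case False
    then have "(z, z') \<in> adjacency (E - {{a, b}})"
      using step.hyps(1) by (auto simp: adjacency_def)
    then show ?thesis using step.IH by (meson converse_rtrancl_into_rtrancl)
  qed
qed

text \<open>Each added point pays for one edge of \<open>E\<close>: the crossing edge that its contraction makes
  dispensable, whose weight bounds the cost \<open>c j\<close> of the step by the hypothesis \<open>cut\<close>. Starting the
  sum at an arbitrary \<open>i\<close>, with the first \<open>i\<close> points contracted, makes the induction work.\<close>

lemma cut_steps_le_connecting_edges: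
  fixes w :: "'a set \<Rightarrow> real" and x :: "nat \<Rightarrow> 'a"
  assumes "finite E" "\<And>e. e \<in> E \<Longrightarrow> 0 \<le> w e"
    and "\<And>z. z \<in> x ` {1..n} \<Longrightarrow> \<exists>u\<in>x ` {1..i}. (z, u) \<in> (adjacency E)\<^sup>*"
    and cut: "\<And>j u y. \<lbrakk>i \<le> j; j < n; u \<in> x ` {1..j}; y \<notin> x ` {1..j}; {u, y} \<in> E\<rbrakk>
      \<Longrightarrow> c j \<le> w {u, y}"
    and inj: "inj_on x {1..n}"
    and "i \<le> n"
  shows "sum c {i..<n} \<le> sum w E"
  using assms(6,1,2,3,4)
proof (induction i arbitrary: E rule: inc_induct)
  case base
  then show ?case by (simp add: sum_nonneg)
next
  case (step i)
  let ?P = "x ` {1..i}" and ?t = "x (Suc i)"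
  have t: "?t \<notin> ?P"
  proof
    assume "?t \<in> ?P"
    then obtain k where "1 \<le> k" "k \<le> i" "x (Suc i) = x k" by auto
    then show False using inj_onD[OF inj, of "Suc i" k] step.hyps by simp
  qed
  have "?t \<in> x ` {1..n}" using step.hyps by simp
  then obtain u where "u \<in> ?P" "(?t, u) \<in> (adjacency E)\<^sup>*"
    using step.prems(3) by blast
  then have "u \<in> ?P" "(u, ?t) \<in> (adjacency E)\<^sup>*"
    by (simp_all only: adjacency_rtrancl_sym)
  then obtain a b where ab: "a \<in> ?P" "b \<notin> ?P" "{a, b} \<in> E"
      "(b, ?t) \<in> (adjacency (E - {{a, b}}))\<^sup>*"
    using t last_crossing_edge by metis
  have "insert ?t ?P = x ` {1..Suc i}" by (simp add: atLeastAtMostSuc_conv)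
  then have reach: "\<exists>u\<in>x ` {1..Suc i}. (z, u) \<in> (adjacency (E - {{a, b}}))\<^sup>*"
    if "z \<in> x ` {1..n}" for z
    using step.prems(3)[OF that] contract_and_delete[OF _ _ ab(1,4), of z] by (elim bexE) simp
  have "sum c {Suc i..<n} \<le> sum w (E - {{a, b}})"
  proof (rule step.IH)
    show "finite (E - {{a, b}})" using step.prems(1) by simp
    show "0 \<le> w e" if "e \<in> E - {{a, b}}" for e using that step.prems(2) by simp
    show "c j \<le> w {u, y}"
      if "Suc i \<le> j" "j < n" "u \<in> x ` {1..j}" "y \<notin> x ` {1..j}" "{u, y} \<in> E - {{a, b}}" for j u y
      using that by (intro step.prems(4)) simp_all
  qed (rule reach)
  moreover have "c i \<le> w {a, b}"
    using step.prems(4)[OF order_refl _ ab(1-3)] step.hyps by simp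
  moreover have "sum w E = w {a, b} + sum w (E - {{a, b}})"
    using step.prems(1) ab(3) by (rule sum.remove)
  moreover have "sum c {i..<n} = c i + sum c {Suc i..<n}"
    using step.hyps by (simp add: sum.atLeast_Suc_lessThan)
  ultimately show ?case by simp
qed


section \<open>The representing tree\<close>

context Ultrametric_space
begin

lemma mdiam_singleton: "a \<in> M \<Longrightarrow> mdiam d {a} = 0"
  by (simp add: mdiam_def)

lemma mdiam_pos_imp_card:
  assumes "finite A" "A \<subseteq> M" "0 < mdiam d A"
  shows "2 \<le> card A"
proof (rule ccontr)
  assume "\<not> 2 \<le> card A"
  then have "A = {} \<or> (\<exists>a. A = {a})"
    using assms(1) by (metis One_nat_def card_1_singletonE card_eq_0_iff less_2_cases not_le)
  then show False
    using assms mdiam_singleton by (auto simp: mdiam_def)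
qed

lemma equiv_less_mdiam:
  assumes "A \<subseteq> M" "0 < mdiam d A"
  shows "equiv A {(u, v) \<in> A \<times> A. d u v < mdiam d A}"
proof (rule equivI)
  let ?r = "{(u, v) \<in> A \<times> A. d u v < mdiam d A}"
  show "?r \<subseteq> A \<times> A" by blast
  show "refl_on A ?r" using assms by (auto simp: refl_on_def subset_iff)
  show "sym ?r" by (auto simp: sym_def commute)
  show "trans ?r"
  proof (rule transI, clarsimp)
    fix u v t
    assume "u \<in> A" "v \<in> A" "t \<in> A" "d u v < mdiam d A" "d v t < mdiam d A"
    then show "d u t < mdiam d A"
      using ultrametric[of u t v] assms(1) by (auto simp: subset_iff)
  qed
qed

lemma parts_eq_quotient:
  assumes "finite A" "A \<subseteq> M" "0 < mdiam d A"
  shows "parts (diametrical_graph d A) = A // {(u, v) \<in> A \<times> A. d u v < mdiam d A}"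
  using diametrical_graph_parts(2) mdiam_pos_imp_card assms by blast

lemma less_mdiam_of_part:
  assumes "finite A" "A \<subseteq> M" "0 < mdiam d A" "B \<in> parts (diametrical_graph d A)"
    and "u \<in> B" "v \<in> B"
  shows "u \<in> A \<and> v \<in> A \<and> d u v < mdiam d A"
proof -
  let ?r = "{(u, v) \<in> A \<times> A. d u v < mdiam d A}"
  have "(u, v) \<in> ?r"
    using quotient_eq_iff[OF equiv_less_mdiam[OF assms(2,3)], of B B u v]
      parts_eq_quotient[OF assms(1-3)] assms by simp
  then show ?thesis by simp
qed

lemma part_exists:
  assumes "finite A" "A \<subseteq> M" "0 < mdiam d A" "u \<in> A" "v \<in> A" "d u v < mdiam d A"
  obtains B where "B \<in> parts (diametrical_graph d A)" "u \<in> B" "v \<in> B"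
proof -
  let ?r = "{(u, v) \<in> A \<times> A. d u v < mdiam d A}"
  have "?r `` {u} \<in> parts (diametrical_graph d A)"
    unfolding parts_eq_quotient[OF assms(1-3)] using assms(4) by (rule quotientI)
  moreover have "u \<in> ?r `` {u}" "v \<in> ?r `` {u}"
    using assms by auto
  ultimately show thesis by (rule that)
qed

lemma part_psubset:
  assumes "finite A" "A \<subseteq> M" "0 < mdiam d A" "B \<in> parts (diametrical_graph d A)"
  shows "B \<noteq> {}" "B \<subset> A"
proof -
  show "B \<noteq> {}"
    using in_quotient_imp_non_empty[OF equiv_less_mdiam[OF assms(2,3)]] assms(4)
    unfolding parts_eq_quotient[OF assms(1-3)] by blast
  have "A \<noteq> {}" using assms(3) by (auto simp: mdiam_def)
  have "mdiam d A = Max ((\<lambda>(u, v). d u v) ` (A \<times> A))"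
    using assms(1) \<open>A \<noteq> {}\<close> by (simp add: mdiam_def cSup_eq_Max)
  also have "\<dots> \<in> (\<lambda>(u, v). d u v) ` (A \<times> A)"
    using assms(1) \<open>A \<noteq> {}\<close> by (intro Max_in) auto
  finally obtain u v where "u \<in> A" "v \<in> A" "d u v = mdiam d A" by auto
  then have "\<not> (u \<in> B \<and> v \<in> B)" using less_mdiam_of_part[OF assms] by fastforce
  moreover have "B \<subseteq> A" using less_mdiam_of_part[OF assms] by blast
  ultimately show "B \<subset> A" using \<open>u \<in> A\<close> \<open>v \<in> A\<close> by blast
qed

lemma parts_disjoint:
  assumes "finite A" "A \<subseteq> M" "0 < mdiam d A"
    and "B \<in> parts (diametrical_graph d A)" "C \<in> parts (diametrical_graph d A)" "z \<in> B" "z \<in> C"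
  shows "B = C"
  using quotient_disj[OF equiv_less_mdiam[OF assms(2,3)], of B C] assms(4-)
  unfolding parts_eq_quotient[OF assms(1-3)] by blast

end

locale finite_Ultrametric_space = Ultrametric_space +
  assumes finite_M: "finite M" and nonempty_M: "M \<noteq> {}"
begin

abbreviation arcs :: "'a set rel" where
  "arcs \<equiv> tree_arcs (rep_tree d M)"

lemma arcs_iff:
  "(A, B) \<in> arcs \<longleftrightarrow>
    A \<in> rep_nodes d M \<and> 0 < mdiam d A \<and> B \<in> parts (diametrical_graph d A)"
  by (simp add: rep_tree_def)

lemma node_subset: "A \<in> rep_nodes d M \<Longrightarrow> A \<noteq> {} \<and> A \<subseteq> M"
proof (induction rule: rep_nodes.induct)
  case root
  then show ?case using nonempty_M by simp
next
  case (child A B)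
  then show ?case
    using part_psubset[of A B] finite_subset[OF _ finite_M] by auto
qed

lemma node_finite: "A \<in> rep_nodes d M \<Longrightarrow> finite A"
  using node_subset finite_M finite_subset by blast

lemma arcs_psubset: "(A, B) \<in> arcs \<Longrightarrow> B \<subset> A"
  using part_psubset(2)[of A B] node_finite[of A] node_subset[of A] by (simp add: arcs_iff)

lemma arcs_trancl_psubset: "(A, B) \<in> arcs\<^sup>+ \<Longrightarrow> B \<subset> A"
  by (induction rule: trancl_induct) (blast dest: arcs_psubset)+

lemma arcs_rtrancl_subset: "(A, B) \<in> arcs\<^sup>* \<Longrightarrow> B \<subseteq> A"
  using arcs_trancl_psubset by (metis order_refl psubset_imp_subset rtranclD)

lemma node_has_leaf:
  assumes "A \<in> rep_nodes d M" "z \<in> A"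
  shows "(A, {z}) \<in> arcs\<^sup>*"
  using node_finite[OF assms(1)] assms
proof (induction A rule: finite_psubset_induct)
  case (psubset A)
  note sub = node_subset[OF psubset.prems(1)]
  have z: "z \<in> M" using sub psubset.prems(2) by blast
  show ?case
  proof (cases "0 < mdiam d A")
    case True
    then obtain B where B: "B \<in> parts (diametrical_graph d A)" "z \<in> B"
      using part_exists[of A z z] psubset sub z by auto
    then have arc: "(A, B) \<in> arcs" using True psubset.prems by (simp add: arcs_iff)
    moreover have "B \<in> rep_nodes d M"
      using psubset.prems(1) True B(1) by (rule rep_nodes.child)
    ultimately show ?thesis
      using psubset.IH[OF arcs_psubset[OF arc] _ B(2)] by (meson converse_rtrancl_into_rtrancl)
  next
    case False
    have "A = {z}"
    proof (rule ccontr)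
      assume "A \<noteq> {z}"
      then obtain a where "a \<in> A" "a \<noteq> z" using psubset.prems(2) by blast
      then have "0 < d a z" using sub z by (simp add: mdist_pos_less subset_iff)
      then show False
        using False mdiam_ge[OF psubset.hyps \<open>a \<in> A\<close> psubset.prems(2)] by simp
    qed
    then show ?thesis by simp
  qed
qed

lemma leaf_points_subtree:
  assumes "A \<in> rep_nodes d M"
  shows "leaf_points (subtree (rep_tree d M) A) = A"
proof (intro set_eqI iffI)
  fix z assume "z \<in> leaf_points (subtree (rep_tree d M) A)"
  then have "(A, {z}) \<in> arcs\<^sup>*"
    by (simp add: leaf_points_def leaves_def subtree_def Let_def)
  then show "z \<in> A" using arcs_rtrancl_subset by blast
next
  fix z assume z: "z \<in> A"
  then have "z \<in> M" using node_subset[OF assms] by blast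
  then have "({z}, B) \<notin> arcs" for B by (simp add: arcs_iff mdiam_singleton)
  then show "z \<in> leaf_points (subtree (rep_tree d M) A)"
    using node_has_leaf[OF assms z]
    by (auto simp: leaf_points_def leaves_def subtree_def Let_def)
qed

text \<open>Siblings are disjoint, so a point determines the branch down which it is found. Depths are
  expressed by relation powers as long as \<open>level\<close>, a definite description, is not known to be
  well defined.\<close>

lemma same_depth_eq:
  assumes "(M, A) \<in> arcs ^^ k" "(M, B) \<in> arcs ^^ k" "z \<in> A" "z \<in> B"
  shows "A = B"
  using assms
proof (induction k arbitrary: A B)
  case (Suc k)
  then obtain A' B' where A': "(M, A') \<in> arcs ^^ k" "(A', A) \<in> arcs"
      and B': "(M, B') \<in> arcs ^^ k" "(B', B) \<in> arcs" by auto
  then have "A' = B'" 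
    using Suc.IH[of A' B'] Suc.prems(3,4) arcs_psubset[OF A'(2)] arcs_psubset[OF B'(2)] by blast
  then show ?case
    using A' B' Suc.prems(3,4) parts_disjoint[of A' A B z] node_finite[of A'] node_subset[of A']
    by (auto simp: arcs_iff)
qed simp

lemma deeper_node_descends:
  assumes "(M, A) \<in> arcs ^^ k" "(M, B) \<in> arcs ^^ (k + m)" "z \<in> A" "z \<in> B"
  shows "(A, B) \<in> arcs ^^ m"
proof -
  obtain C where C: "(M, C) \<in> arcs ^^ k" "(C, B) \<in> arcs ^^ m"
    using assms(2) by (auto simp: relpow_add)
  then have "z \<in> C" using assms(4) arcs_rtrancl_subset relpow_imp_rtrancl by blast
  then show ?thesis using same_depth_eq[OF assms(1) C(1) assms(3)] C(2) by simp
qed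

lemma depth_unique:
  assumes "(M, A) \<in> arcs ^^ k" "(M, A) \<in> arcs ^^ l" "A \<noteq> {}"
  shows "k = l"
proof -
  have "\<not> k < l" if kl: "(M, A) \<in> arcs ^^ k" "(M, A) \<in> arcs ^^ l" for k l
  proof
    assume "k < l"
    then have "(A, A) \<in> arcs ^^ (l - k)"
      using deeper_node_descends[of A k A "l - k"] kl assms(3) by auto
    then have "(A, A) \<in> arcs\<^sup>+"
      using \<open>k < l\<close> unfolding trancl_power by (meson zero_less_diff)
    then show False using arcs_trancl_psubset by blast
  qed
  then show ?thesis using assms by (meson linorder_neqE_nat)
qed

lemma node_at_level:
  assumes "A \<in> rep_nodes d M"
  shows "(M, A) \<in> arcs ^^ level (rep_tree d M) A"
proof -
  have "\<exists>k. (M, A) \<in> arcs ^^ k"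
    using assms
  proof (induction rule: rep_nodes.induct)
    case root
    then show ?case by (metis relpow_0_I)
  next
    case (child A B)
    then have "(A, B) \<in> arcs" by (simp add: arcs_iff)
    then show ?case using child.IH by (meson relpow_Suc_I)
  qed
  then obtain k where k: "(M, A) \<in> arcs ^^ k" ..
  have "(M, A) \<in> arcs ^^ (THE k. (M, A) \<in> arcs ^^ k)"
  proof (rule theI)
    show "l = k" if "(M, A) \<in> arcs ^^ l" for l
      using that k node_subset[OF assms] by (blast intro: depth_unique)
  qed (rule k)
  then show ?thesis by (simp add: level_def rep_tree_def)
qed

text \<open>Among the nodes containing a given point, being deepest thus means being smallest.\<close>

lemma deeper_node_subset:
  assumes "A \<in> rep_nodes d M" "B \<in> rep_nodes d M" "z \<in> A" "z \<in> B"
    and "level (rep_tree d M) A \<le> level (rep_tree d M) B"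
  shows "B \<subseteq> A"
proof -
  obtain m where "level (rep_tree d M) B = level (rep_tree d M) A + m"
    using assms(5) by (meson le_Suc_ex)
  then have "(A, B) \<in> arcs ^^ m"
    using node_at_level[OF assms(1)] node_at_level[OF assms(2)] assms(3,4)
    by (metis deeper_node_descends)
  then show ?thesis using arcs_rtrancl_subset relpow_imp_rtrancl by blast
qed

text \<open>Two points stay in a common node until they reach one whose diameter is their distance;
  there they are separated. This is how the tree encodes the metric.\<close>

lemma node_with_mdiam_eq_dist:
  assumes "u \<in> M" "v \<in> M" "u \<noteq> v"
  obtains A where "A \<in> rep_nodes d M" "u \<in> A" "v \<in> A" "mdiam d A = d u v"
proof -
  have "\<exists>A'\<in>rep_nodes d M. u \<in> A' \<and> v \<in> A' \<and> mdiam d A' = d u v"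
    if "finite A" "A \<in> rep_nodes d M" "u \<in> A" "v \<in> A" for A
    using that
  proof (induction A rule: finite_psubset_induct)
    case (psubset A)
    note sub = node_subset[OF psubset.prems(1)]
    have le: "d u v \<le> mdiam d A"
      using mdiam_ge psubset by blast
    show ?case
    proof (cases "d u v = mdiam d A")
      case True
      then show ?thesis using psubset.prems by metis
    next
      case False
      have pos: "0 < mdiam d A" using le mdist_pos_less[OF assms(3,1,2)] by linarith
      obtain B where B: "B \<in> parts (diametrical_graph d A)" "u \<in> B" "v \<in> B"
        using part_exists[of A u v] psubset sub pos le False by auto
      then have "B \<in> rep_nodes d M" "B \<subset> A"
        using rep_nodes.child[OF psubset.prems(1) pos] part_psubset[OF psubset.hyps _ pos] sub
        by blast+
      then show ?thesis using psubset.IH B by blast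
    qed
  qed
  from this[OF finite_M rep_nodes.root assms(1,2)] that show thesis by blast
qed


section \<open>The walk produced by the algorithm\<close>

text \<open>For an unvisited \<open>y\<close>, the smallest node containing \<open>x i\<close> and \<open>y\<close> is one of the candidates.
  The chosen node lies inside it, and so its points are at distance at most \<open>d (x i) y\<close> from
  \<open>x i\<close>.\<close>

lemma deepest_node_run_step:
  assumes "deepest_node_run d M x" "1 \<le> i" "i < card M"
  shows "x (Suc i) \<in> M - x ` {1..i}"
    and "\<And>y. y \<in> M - x ` {1..i} \<Longrightarrow> x i \<in> M \<Longrightarrow> d (x i) (x (Suc i)) \<le> d (x i) y"
proof -
  let ?T = "rep_tree d M"
  let ?candidate = "\<lambda>v. v \<in> rep_nodes d M \<and> x i \<in> v \<and> v - x ` {1..i} \<noteq> {}"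
  have nodes: "nodes ?T = rep_nodes d M" by (simp add: rep_tree_def)
  obtain v where v: "?candidate v" "x (Suc i) \<in> v - x ` {1..i}"
      and deepest: "\<And>B. ?candidate B \<Longrightarrow> level ?T B \<le> level ?T v"
  proof -
    have "i \<in> {1..<card M}" using assms(2,3) by simp
    then obtain v where arg_max: "is_arg_max (level ?T)
        (\<lambda>v. v \<in> nodes ?T \<and> x i \<in> leaf_points (subtree ?T v) \<and>
             leaf_points (subtree ?T v) - x ` {1..i} \<noteq> {}) v"
      and next_point: "x (Suc i) \<in> leaf_points (subtree ?T v) - x ` {1..i}"
      using assms(1) unfolding deepest_node_run_def Suc_eq_plus1 by blast
    then have "v \<in> rep_nodes d M" by (simp add: is_arg_max_def nodes)
    then have v: "leaf_points (subtree ?T v) = v" by (rule leaf_points_subtree)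
    have "?candidate v" using arg_max unfolding is_arg_max_def nodes v by simp
    moreover have "x (Suc i) \<in> v - x ` {1..i}" using next_point unfolding v .
    moreover have "level ?T B \<le> level ?T v" if "?candidate B" for B
      using arg_max that leaf_points_subtree[of B] unfolding is_arg_max_def nodes
      by (metis not_less)
    ultimately show ?thesis by (rule that)
  qed
  show "x (Suc i) \<in> M - x ` {1..i}" using v node_subset by blast
  fix y assume y: "y \<in> M - x ` {1..i}" "x i \<in> M"
  then have "x i \<noteq> y" using assms(2) by auto
  with y obtain B where B: "B \<in> rep_nodes d M" "x i \<in> B" "y \<in> B" "mdiam d B = d (x i) y"
    using node_with_mdiam_eq_dist[of "x i" y] by blast
  then have "level ?T B \<le> level ?T v" using y by (intro deepest) blast
  then have "v \<subseteq> B" using deeper_node_subset B v by blast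
  then have "d (x i) (x (Suc i)) \<le> mdiam d B"
    using B v node_finite by (intro mdiam_ge) auto
  then show "d (x i) (x (Suc i)) \<le> d (x i) y" using B by simp
qed

lemma deepest_node_run_in:
  assumes "deepest_node_run d M x" "1 \<le> i" "i \<le> card M"
  shows "x i \<in> M"
proof (cases "i = 1")
  case True
  then show ?thesis using assms by (simp add: deepest_node_run_def)
next
  case False
  then show ?thesis using deepest_node_run_step(1)[of x "i - 1"] assms by simp
qed

lemma deepest_node_run_nearest:
  assumes "deepest_node_run d M x" "1 \<le> i" "i < card M" "y \<in> M - x ` {1..i}"
  shows "d (x i) (x (Suc i)) \<le> d (x i) y"
  using deepest_node_run_step(2)[OF assms(1-4)] deepest_node_run_in[OF assms(1,2)] assms(3)
  by simp

lemma deepest_node_run_bij: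
  assumes "deepest_node_run d M x"
  shows "bij_betw x {1..card M} M"
proof -
  have "x i \<noteq> x j" if "1 \<le> i" "i < j" "j \<le> card M" for i j
  proof -
    have "x j \<notin> x ` {1..j - 1}"
      using deepest_node_run_step(1)[OF assms, of "j - 1"] that by simp
    moreover have "i \<in> {1..j - 1}" using that by auto
    ultimately show ?thesis by (metis imageI)
  qed
  then have "inj_on x {1..card M}"
    by (intro linorder_inj_onI) auto
  moreover have "x ` {1..card M} \<subseteq> M" using deepest_node_run_in[OF assms] by auto
  ultimately show ?thesis
    using finite_M by (simp add: bij_betw_def card_image card_subset_eq)
qed

end

text \<open>When the walk visited \<open>u\<close>, it was in the ball of radius \<open>d u y\<close> around the unvisited point
  \<open>y\<close>. It has not left this ball since: from a point of the ball, \<open>y\<close> was always available at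
  distance at most \<open>d u y\<close>, and in an ultrametric a step of at most that length stays in the ball.
  So \<open>x i\<close> is in the ball too, and \<open>y\<close> bounds the length of the next step.\<close>

lemma (in Ultrametric_space) nearest_neighbour_crosses_cut:
  assumes "x ` {1..n} \<subseteq> M"
    and nearest: "\<And>i y. \<lbrakk>1 \<le> i; i < n; y \<in> M - x ` {1..i}\<rbrakk> \<Longrightarrow> d (x i) (x (Suc i)) \<le> d (x i) y"
    and "i < n" "u \<in> x ` {1..i}" "y \<in> M - x ` {1..i}"
  shows "d (x i) (x (Suc i)) \<le> d u y"
proof -
  from assms(4) obtain j where j: "1 \<le> j" "j \<le> i" "u = x j" by auto
  have "d (x k) y \<le> d u y" if "j \<le> k" "k \<le> i" for k
    using that
  proof (induction k rule: dec_induct)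
    case (step k)
    have in_M: "x k \<in> M" "x (Suc k) \<in> M" "y \<in> M"
      using assms(1,3,5) j(1) step by auto
    have "y \<notin> x ` {1..k}" using assms(5) step by auto
    then have "d (x k) (x (Suc k)) \<le> d (x k) y"
      using step j assms(3) in_M by (intro nearest) auto
    moreover have "d (x (Suc k)) y \<le> max (d (x (Suc k)) (x k)) (d (x k) y)"
      using in_M by (intro ultrametric) auto
    ultimately show ?case using step by (simp add: commute)
  qed (simp add: j)
  from this[of i] nearest[of i y] j assms(3,5) show ?thesis by simp
qed


section \<open>Optimality of the walk\<close>

lemma walk_is_path:
  fixes x :: "nat \<Rightarrow> 'a"
  assumes "inj_on x {1..n}" "1 \<le> n"
  shows "is_path \<lparr>verts = x ` {1..n}, edges = {{x i, x (i + 1)} | i. i \<in> {1..<n}}\<rparr>"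
proof -
  let ?xs = "map x [1..<Suc n]"
  have "{{x i, x (i + 1)} | i. i \<in> {1..<n}} = path_edges ?xs"
  proof (intro set_eqI iffI)
    fix e assume "e \<in> {{x i, x (i + 1)} | i. i \<in> {1..<n}}"
    then obtain i where "1 \<le> i" "i < n" "e = {x i, x (i + 1)}" by auto
    then have "Suc (i - 1) < length ?xs" "e = {?xs ! (i - 1), ?xs ! Suc (i - 1)}"
      by (auto simp del: upt_Suc)
    then show "e \<in> path_edges ?xs" unfolding path_edges_def by blast
  next
    fix e assume "e \<in> path_edges ?xs"
    then obtain i where "Suc i < length ?xs" "e = {?xs ! i, ?xs ! Suc i}"
      by (rule path_edgesE)
    then have "Suc i \<in> {1..<n}" "e = {x (Suc i), x (Suc i + 1)}"
      by (auto simp del: upt_Suc)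
    then show "e \<in> {{x i, x (i + 1)} | i. i \<in> {1..<n}}" by blast
  qed
  moreover have "set [1..<Suc n] = {1..n}" by auto
  then have "distinct ?xs" "set ?xs = x ` {1..n}"
    using assms(1) by (simp_all only: distinct_map distinct_upt set_map simp_thms)
  moreover have "?xs \<noteq> []" using assms(2) by simp
  ultimately show ?thesis
    unfolding is_path_def by (metis ugraph.select_convs)
qed

theorem proposition2p5:
  fixes X :: "'a set" and d :: "'a \<Rightarrow> 'a \<Rightarrow> real" and x :: "nat \<Rightarrow> 'a" and n :: nat
  assumes "Ultrametric_space X d" and "finite X" and "X \<noteq> {}" and "card X = n"
    and "deepest_node_run d X x"
  shows "x ` {1..n} = X \<and>
    metric_minimum_spanning_path X d
      \<lparr>verts = x ` {1..n}, edges = {{x i, x (i + 1)} | i. i \<in> {1..<n}}\<rparr>"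
proof -
  interpret Ultrametric_space X d by fact
  interpret finite_Ultrametric_space X d by unfold_locales fact+
  let ?G = "\<lparr>verts = x ` {1..n}, edges = {{x i, x (i + 1)} | i. i \<in> {1..<n}}\<rparr>"
  let ?w = "metric_weight d"
  have bij: "inj_on x {1..n}" "x ` {1..n} = X"
    using deepest_node_run_bij[OF assms(5)] assms(4) by (auto simp: bij_betw_def)
  have "1 \<le> n" using assms(2,3) unfolding assms(4)[symmetric] by (simp add: Suc_le_eq card_gt_0_iff)
  then have path: "is_path ?G" using bij(1) by (intro walk_is_path)
  have edges_G: "edges ?G = (\<lambda>i. {x i, x (Suc i)}) ` {1..<n}" by auto
  have "edges ?G \<subseteq> edges (metric_graph X)"
  proof
    fix e assume "e \<in> edges ?G"
    then obtain i where "e = {x i, x (Suc i)}" "i \<in> {1..n}" "Suc i \<in> {1..n}"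
      unfolding edges_G by auto
    moreover from this have "x i \<noteq> x (Suc i)" using bij(1) by (metis inj_onD n_not_Suc_n)
    ultimately show "e \<in> edges (metric_graph X)"
      using bij(2) unfolding metric_graph_def ugraph.select_convs by blast
  qed
  then have spanning: "spanning_tree (metric_graph X) ?G"
    using is_path_imp_is_tree[OF path] bij(2) by (simp add: spanning_tree_def metric_graph_def)
  have minimal: "sum ?w (edges ?G) \<le> sum ?w (edges T)" if T: "spanning_tree (metric_graph X) T" for T
  proof -
    have T': "connected_graph T" "verts T = X"
        "edges T \<subseteq> {{u, v} | u v. u \<in> X \<and> v \<in> X \<and> u \<noteq> v}"
      using T by (auto simp: spanning_tree_def is_tree_def metric_graph_def)
    have "edges T \<subseteq> Pow X" using T'(3) by auto
    then have finite: "finite (edges T)" using assms(2) by (simp add: finite_subset)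
    have nonneg: "0 \<le> ?w e" if "e \<in> edges T" for e
    proof -
      have "e \<in> {{u, v} | u v. u \<in> X \<and> v \<in> X \<and> u \<noteq> v}" using that T'(3) by (rule subsetD[rotated])
      then obtain u v where "e = {u, v}" by blast
      then show ?thesis by simp
    qed
    have "sum ?w (edges ?G) \<le> (\<Sum>i\<in>{1..<n}. ?w {x i, x (Suc i)})"
      unfolding edges_G
      using sum_image_le[of "{1..<n}" ?w "\<lambda>i. {x i, x (Suc i)}"] by (simp add: o_def)
    also have "\<dots> = (\<Sum>i\<in>{1..<n}. d (x i) (x (Suc i)))" by simp
    also have "\<dots> \<le> sum ?w (edges T)"
    proof (rule cut_steps_le_connecting_edges[OF finite nonneg _ _ bij(1) \<open>1 \<le> n\<close>])
      show "\<exists>u\<in>x ` {1..1}. (z, u) \<in> (adjacency (edges T))\<^sup>*" if "z \<in> x ` {1..n}" for z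
      proof -
        have "x 1 \<in> X" using bij(2) \<open>1 \<le> n\<close> by force
        then have "(z, x 1) \<in> (adjacency (edges T))\<^sup>*"
          using that connected_graph_imp_rtrancl[OF T'(1), of z "x 1"] T'(2) bij(2) by simp
        then show ?thesis by simp
      qed
    next
      fix j u y
      assume *: "1 \<le> j" "j < n" "u \<in> x ` {1..j}" "y \<notin> x ` {1..j}" "{u, y} \<in> edges T"
      then have "{u, y} \<subseteq> X" using \<open>edges T \<subseteq> Pow X\<close> by blast
      then have "y \<in> X" by simp
      have "d (x j) (x (Suc j)) \<le> d u y"
      proof (rule nearest_neighbour_crosses_cut)
        show "x ` {1..n} \<subseteq> X" using bij(2) by simp
        show "d (x i) (x (Suc i)) \<le> d (x i) y" if "1 \<le> i" "i < n" "y \<in> X - x ` {1..i}" for i y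
          using that assms(4) by (intro deepest_node_run_nearest[OF assms(5)]) simp_all
        show "y \<in> X - x ` {1..j}" using \<open>y \<in> X\<close> *(4) by blast
      qed (rule *)+
      then show "d (x j) (x (Suc j)) \<le> ?w {u, y}" by simp
    qed
    finally show ?thesis .
  qed
  have "minimum_spanning_tree (metric_graph X) ?w ?G"
    unfolding minimum_spanning_tree_def using spanning minimal by (intro conjI allI impI)
  with path have "metric_minimum_spanning_path X d ?G"
    unfolding metric_minimum_spanning_path_def ..
  with bij(2) show ?thesis ..
qed

end
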